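(* A nearly Sasakian manifold $(M,\phi,\xi,\eta,g)$ admits a linear connection with totally skew-symmetric torsion parallelizing all the structure tensors $\phi,\xi,\eta,g$ if and only if it is Sasakian.
   Context: All manifolds are smooth and connected; $\nabla$ is the Levi-Civita connection of $g$. An almost contact metric structure $(\phi,\xi,\eta,g)$ on $M^{2n+1}$ consists of a $(1,1)$-tensor field $\phi$, a vector field $\xi$, a $1$-form $\eta$ and a Riemannian metric $g$ with $\phi^2=-I+\eta\otimes\xi$, $\eta(\xi)=1$, $g(\phi X,\phi Y)=g(X,Y)-\eta(X)\eta(Y)$. It is Sasakian if $(\nabla_X\phi)Y=g(X,Y)\xi-\eta(Y)X$, and nearly Sasakian if $(\nabla_X\phi)Y+(\nabla_Y\phi)X=2g(X,Y)\xi-\eta(X)Y-\eta(Y)X$ for all vector fields $X,Y$. A linear connection with torsion $T$ has totally skew-symmetric torsion if $(X,Y,Z)\mapsto g(T(X,Y),Z)$ is totally skew-symmetric. *)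

theory Defs
  imports "HOL-Analysis.Analysis" "HOL-Library.Function_Algebras"
begin

text \<open>Addition, subtraction, negation, zero and multiplication of functions are pointwise
  (\<open>HOL-Library.Function_Algebras\<close>), also for functions with values in functions; this covers
  real functions, tangent vectors and vector fields alike.\<close>

section \<open>Smooth manifolds\<close>

primrec Ck_on :: "nat \<Rightarrow> 'a::euclidean_space set \<Rightarrow> ('a \<Rightarrow> 'b::real_normed_vector) \<Rightarrow> bool" where
  "Ck_on 0 S f \<longleftrightarrow> continuous_on S f"
| "Ck_on (Suc k) S f \<longleftrightarrow>
     (\<forall>x\<in>S. f differentiable at x) \<and> (\<forall>v. Ck_on k S (\<lambda>x. frechet_derivative f (at x) v))"

text \<open>Only meant for open \<open>S\<close>, since derivatives are full derivatives at the points of \<open>S\<close>.\<close>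

definition smooth_on :: "'a::euclidean_space set \<Rightarrow> ('a \<Rightarrow> 'b::real_normed_vector) \<Rightarrow> bool" where
  "smooth_on S f \<longleftrightarrow> (\<forall>k. Ck_on k S f)"

text \<open>The underlying set of a manifold is the whole type \<open>'m\<close>, whose type class provides the
  Hausdorff and second countable topology. A chart is a pair \<open>(U, \<psi>)\<close>; the values of \<open>\<psi>\<close>
  outside \<open>U\<close> are irrelevant.\<close>

type_synonym ('m, 'e) atlas = "('m set \<times> ('m \<Rightarrow> 'e)) set"

definition smooth_atlas :: "('m::{t2_space,second_countable_topology}, 'e::euclidean_space) atlas \<Rightarrow> bool"
  where
  "smooth_atlas A \<longleftrightarrow>
     (\<Union>(U, \<psi>)\<in>A. U) = UNIV \<and>
     (\<forall>(U, \<psi>)\<in>A. open U \<and> open (\<psi> ` U) \<and> homeomorphism U (\<psi> ` U) \<psi> (inv_into U \<psi>)) \<and>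
     (\<forall>(U, \<psi>)\<in>A. \<forall>(V, \<psi>')\<in>A. smooth_on (\<psi> ` (U \<inter> V)) (\<psi>' \<circ> inv_into U \<psi>))"

definition smooth_manifold :: "('m::{t2_space,second_countable_topology}, 'e::euclidean_space) atlas \<Rightarrow> bool"
  where "smooth_manifold A \<longleftrightarrow> smooth_atlas A \<and> connected (UNIV :: 'm set)"

definition smooth_fun ::
  "('m::{t2_space,second_countable_topology}, 'e::euclidean_space) atlas \<Rightarrow> ('m \<Rightarrow> real) \<Rightarrow> bool"
  where "smooth_fun A f \<longleftrightarrow> (\<forall>(U, \<psi>)\<in>A. smooth_on (\<psi> ` U) (f \<circ> inv_into U \<psi>))"

section \<open>Tangent vectors and vector fields\<close>

text \<open>A tangent vector at \<open>p\<close> is a derivation at \<open>p\<close> of the algebra of smooth functions. Since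
  functionals are total, the value on non-smooth functions is fixed to be \<open>0\<close>; otherwise a
  derivation would not be determined by its values on smooth functions.\<close>

type_synonym 'm tvec = "('m \<Rightarrow> real) \<Rightarrow> real"
type_synonym 'm vfield = "'m \<Rightarrow> 'm tvec"

definition tscale :: "real \<Rightarrow> 'm tvec \<Rightarrow> 'm tvec" where
  "tscale c v = (\<lambda>f. c * v f)"

definition tangent_space ::
  "('m::{t2_space,second_countable_topology}, 'e::euclidean_space) atlas \<Rightarrow> 'm \<Rightarrow> 'm tvec set" where
  "tangent_space A p = {v.
     (\<forall>f h. smooth_fun A f \<longrightarrow> smooth_fun A h \<longrightarrow> v (f + h) = v f + v h) \<and>
     (\<forall>c f. smooth_fun A f \<longrightarrow> v (\<lambda>q. c * f q) = c * v f) \<and>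
     (\<forall>f h. smooth_fun A f \<longrightarrow> smooth_fun A h \<longrightarrow> v (f * h) = v f * h p + f p * v h) \<and>
     (\<forall>f. \<not> smooth_fun A f \<longrightarrow> v f = 0)}"

definition deriv_along :: "'m vfield \<Rightarrow> ('m \<Rightarrow> real) \<Rightarrow> 'm \<Rightarrow> real" where
  "deriv_along X f = (\<lambda>p. X p f)"

definition vector_field ::
  "('m::{t2_space,second_countable_topology}, 'e::euclidean_space) atlas \<Rightarrow> 'm vfield \<Rightarrow> bool" where
  "vector_field A X \<longleftrightarrow>
     (\<forall>p. X p \<in> tangent_space A p) \<and> (\<forall>f. smooth_fun A f \<longrightarrow> smooth_fun A (deriv_along X f))"

definition fscale :: "('m \<Rightarrow> real) \<Rightarrow> 'm vfield \<Rightarrow> 'm vfield" where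
  "fscale f X = (\<lambda>p. tscale (f p) (X p))"

definition lie_bracket :: "'m vfield \<Rightarrow> 'm vfield \<Rightarrow> 'm vfield" where
  "lie_bracket X Y = (\<lambda>p f. X p (deriv_along Y f) - Y p (deriv_along X f))"

section \<open>Tensor fields\<close>

text \<open>Tensor fields are families of multilinear maps on the tangent spaces, only constrained on
  actual tangent vectors; such a family is smooth if it sends smooth vector fields to a smooth
  function or vector field. \<open>ap1\<close> and \<open>ap2\<close> evaluate tensor fields on vector fields.\<close>

definition ap1 :: "('m \<Rightarrow> 'm tvec \<Rightarrow> 'b) \<Rightarrow> 'm vfield \<Rightarrow> 'm \<Rightarrow> 'b" where
  "ap1 T X = (\<lambda>p. T p (X p))"

definition ap2 :: "('m \<Rightarrow> 'm tvec \<Rightarrow> 'm tvec \<Rightarrow> 'b) \<Rightarrow> 'm vfield \<Rightarrow> 'm vfield \<Rightarrow> 'm \<Rightarrow> 'b" where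
  "ap2 T X Y = (\<lambda>p. T p (X p) (Y p))"

definition endo_field ::
  "('m::{t2_space,second_countable_topology}, 'e::euclidean_space) atlas \<Rightarrow> ('m \<Rightarrow> 'm tvec \<Rightarrow> 'm tvec) \<Rightarrow> bool"
  where
  "endo_field A \<phi> \<longleftrightarrow>
     (\<forall>p. \<forall>v\<in>tangent_space A p. \<phi> p v \<in> tangent_space A p) \<and>
     (\<forall>p. \<forall>v\<in>tangent_space A p. \<forall>w\<in>tangent_space A p. \<phi> p (v + w) = \<phi> p v + \<phi> p w) \<and>
     (\<forall>p c. \<forall>v\<in>tangent_space A p. \<phi> p (tscale c v) = tscale c (\<phi> p v)) \<and>
     (\<forall>X. vector_field A X \<longrightarrow> vector_field A (ap1 \<phi> X))"

definition one_form ::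
  "('m::{t2_space,second_countable_topology}, 'e::euclidean_space) atlas \<Rightarrow> ('m \<Rightarrow> 'm tvec \<Rightarrow> real) \<Rightarrow> bool"
  where
  "one_form A \<eta> \<longleftrightarrow>
     (\<forall>p. \<forall>v\<in>tangent_space A p. \<forall>w\<in>tangent_space A p. \<eta> p (v + w) = \<eta> p v + \<eta> p w) \<and>
     (\<forall>p c. \<forall>v\<in>tangent_space A p. \<eta> p (tscale c v) = c * \<eta> p v) \<and>
     (\<forall>X. vector_field A X \<longrightarrow> smooth_fun A (ap1 \<eta> X))"

definition riemannian_metric ::
  "('m::{t2_space,second_countable_topology}, 'e::euclidean_space) atlas
     \<Rightarrow> ('m \<Rightarrow> 'm tvec \<Rightarrow> 'm tvec \<Rightarrow> real) \<Rightarrow> bool" where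
  "riemannian_metric A g \<longleftrightarrow>
     (\<forall>p. \<forall>u\<in>tangent_space A p. \<forall>v\<in>tangent_space A p. \<forall>w\<in>tangent_space A p.
        g p (u + v) w = g p u w + g p v w) \<and>
     (\<forall>p c. \<forall>v\<in>tangent_space A p. \<forall>w\<in>tangent_space A p. g p (tscale c v) w = c * g p v w) \<and>
     (\<forall>p. \<forall>v\<in>tangent_space A p. \<forall>w\<in>tangent_space A p. g p v w = g p w v) \<and>
     (\<forall>p. \<forall>v\<in>tangent_space A p. v \<noteq> 0 \<longrightarrow> g p v v > 0) \<and>
     (\<forall>X Y. vector_field A X \<longrightarrow> vector_field A Y \<longrightarrow> smooth_fun A (ap2 g X Y))"

section \<open>Linear connections\<close>

text \<open>The values \<open>D X Y\<close> for arguments that are not vector fields are irrelevant.\<close>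

type_synonym 'm connection = "'m vfield \<Rightarrow> 'm vfield \<Rightarrow> 'm vfield"

definition linear_connection ::
  "('m::{t2_space,second_countable_topology}, 'e::euclidean_space) atlas \<Rightarrow> 'm connection \<Rightarrow> bool" where
  "linear_connection A D \<longleftrightarrow>
     (\<forall>X Y. vector_field A X \<longrightarrow> vector_field A Y \<longrightarrow> vector_field A (D X Y)) \<and>
     (\<forall>X Y Z. vector_field A X \<longrightarrow> vector_field A Y \<longrightarrow> vector_field A Z \<longrightarrow>
        D (X + Y) Z = D X Z + D Y Z \<and> D X (Y + Z) = D X Y + D X Z) \<and>
     (\<forall>f X Y. smooth_fun A f \<longrightarrow> vector_field A X \<longrightarrow> vector_field A Y \<longrightarrow>
        D (fscale f X) Y = fscale f (D X Y) \<and>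
        D X (fscale f Y) = fscale (deriv_along X f) Y + fscale f (D X Y))"

definition torsion :: "'m connection \<Rightarrow> 'm vfield \<Rightarrow> 'm vfield \<Rightarrow> 'm vfield" where
  "torsion D X Y = D X Y - D Y X - lie_bracket X Y"

definition cov_endo ::
  "'m connection \<Rightarrow> ('m \<Rightarrow> 'm tvec \<Rightarrow> 'm tvec) \<Rightarrow> 'm vfield \<Rightarrow> 'm vfield \<Rightarrow> 'm vfield" where
  "cov_endo D \<phi> X Y = D X (ap1 \<phi> Y) - ap1 \<phi> (D X Y)"

definition cov_form ::
  "'m connection \<Rightarrow> ('m \<Rightarrow> 'm tvec \<Rightarrow> real) \<Rightarrow> 'm vfield \<Rightarrow> 'm vfield \<Rightarrow> 'm \<Rightarrow> real" where
  "cov_form D \<eta> X Y = deriv_along X (ap1 \<eta> Y) - ap1 \<eta> (D X Y)"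

definition cov_metric ::
  "'m connection \<Rightarrow> ('m \<Rightarrow> 'm tvec \<Rightarrow> 'm tvec \<Rightarrow> real)
     \<Rightarrow> 'm vfield \<Rightarrow> 'm vfield \<Rightarrow> 'm vfield \<Rightarrow> 'm \<Rightarrow> real" where
  "cov_metric D g X Y Z = deriv_along X (ap2 g Y Z) - ap2 g (D X Y) Z - ap2 g Y (D X Z)"

definition parallel_vector ::
  "('m::{t2_space,second_countable_topology}, 'e::euclidean_space) atlas
     \<Rightarrow> 'm connection \<Rightarrow> 'm vfield \<Rightarrow> bool" where
  "parallel_vector A D \<xi> \<longleftrightarrow> (\<forall>X. vector_field A X \<longrightarrow> D X \<xi> = 0)"

definition parallel_endo ::
  "('m::{t2_space,second_countable_topology}, 'e::euclidean_space) atlas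
     \<Rightarrow> 'm connection \<Rightarrow> ('m \<Rightarrow> 'm tvec \<Rightarrow> 'm tvec) \<Rightarrow> bool" where
  "parallel_endo A D \<phi> \<longleftrightarrow>
     (\<forall>X Y. vector_field A X \<longrightarrow> vector_field A Y \<longrightarrow> cov_endo D \<phi> X Y = 0)"

definition parallel_form ::
  "('m::{t2_space,second_countable_topology}, 'e::euclidean_space) atlas
     \<Rightarrow> 'm connection \<Rightarrow> ('m \<Rightarrow> 'm tvec \<Rightarrow> real) \<Rightarrow> bool" where
  "parallel_form A D \<eta> \<longleftrightarrow>
     (\<forall>X Y. vector_field A X \<longrightarrow> vector_field A Y \<longrightarrow> cov_form D \<eta> X Y = 0)"

definition parallel_metric ::
  "('m::{t2_space,second_countable_topology}, 'e::euclidean_space) atlas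
     \<Rightarrow> 'm connection \<Rightarrow> ('m \<Rightarrow> 'm tvec \<Rightarrow> 'm tvec \<Rightarrow> real) \<Rightarrow> bool" where
  "parallel_metric A D g \<longleftrightarrow>
     (\<forall>X Y Z. vector_field A X \<longrightarrow> vector_field A Y \<longrightarrow> vector_field A Z \<longrightarrow>
        cov_metric D g X Y Z = 0)"

definition levi_civita ::
  "('m::{t2_space,second_countable_topology}, 'e::euclidean_space) atlas
     \<Rightarrow> ('m \<Rightarrow> 'm tvec \<Rightarrow> 'm tvec \<Rightarrow> real) \<Rightarrow> 'm connection \<Rightarrow> bool" where
  "levi_civita A g D \<longleftrightarrow> linear_connection A D \<and> parallel_metric A D g \<and>
     (\<forall>X Y. vector_field A X \<longrightarrow> vector_field A Y \<longrightarrow> torsion D X Y = 0)"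

definition skew_torsion ::
  "('m::{t2_space,second_countable_topology}, 'e::euclidean_space) atlas
     \<Rightarrow> ('m \<Rightarrow> 'm tvec \<Rightarrow> 'm tvec \<Rightarrow> real) \<Rightarrow> 'm connection \<Rightarrow> bool" where
  "skew_torsion A g D \<longleftrightarrow>
     (\<forall>X Y Z. vector_field A X \<longrightarrow> vector_field A Y \<longrightarrow> vector_field A Z \<longrightarrow>
        ap2 g (torsion D X Y) Z = - ap2 g (torsion D Y X) Z \<and>
        ap2 g (torsion D X Y) Z = - ap2 g (torsion D X Z) Y \<and>
        ap2 g (torsion D X Y) Z = - ap2 g (torsion D Z Y) X)"

section \<open>Almost contact metric structures\<close>

definition almost_contact_metric ::
  "('m::{t2_space,second_countable_topology}, 'e::euclidean_space) atlas \<Rightarrow> nat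
     \<Rightarrow> ('m \<Rightarrow> 'm tvec \<Rightarrow> 'm tvec) \<Rightarrow> 'm vfield \<Rightarrow> ('m \<Rightarrow> 'm tvec \<Rightarrow> real)
     \<Rightarrow> ('m \<Rightarrow> 'm tvec \<Rightarrow> 'm tvec \<Rightarrow> real) \<Rightarrow> bool" where
  "almost_contact_metric A n \<phi> \<xi> \<eta> g \<longleftrightarrow>
     smooth_manifold A \<and> DIM('e) = 2 * n + 1 \<and>
     endo_field A \<phi> \<and> vector_field A \<xi> \<and> one_form A \<eta> \<and> riemannian_metric A g \<and>
     (\<forall>p. \<forall>v\<in>tangent_space A p. \<phi> p (\<phi> p v) = - v + tscale (\<eta> p v) (\<xi> p)) \<and>
     (\<forall>p. \<eta> p (\<xi> p) = 1) \<and>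
     (\<forall>p. \<forall>v\<in>tangent_space A p. \<forall>w\<in>tangent_space A p.
        g p (\<phi> p v) (\<phi> p w) = g p v w - \<eta> p v * \<eta> p w)"

text \<open>The two classes below refer to the Levi-Civita connection of \<open>g\<close>. It is unique on vector
  fields, so an existential quantifier over \<open>D\<close> introduces it.\<close>

definition sasakian ::
  "('m::{t2_space,second_countable_topology}, 'e::euclidean_space) atlas \<Rightarrow> nat
     \<Rightarrow> ('m \<Rightarrow> 'm tvec \<Rightarrow> 'm tvec) \<Rightarrow> 'm vfield \<Rightarrow> ('m \<Rightarrow> 'm tvec \<Rightarrow> real)
     \<Rightarrow> ('m \<Rightarrow> 'm tvec \<Rightarrow> 'm tvec \<Rightarrow> real) \<Rightarrow> bool" where
  "sasakian A n \<phi> \<xi> \<eta> g \<longleftrightarrow> almost_contact_metric A n \<phi> \<xi> \<eta> g \<and>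
     (\<exists>D. levi_civita A g D \<and>
       (\<forall>X Y. vector_field A X \<longrightarrow> vector_field A Y \<longrightarrow>
          cov_endo D \<phi> X Y = fscale (ap2 g X Y) \<xi> - fscale (ap1 \<eta> Y) X))"

definition nearly_sasakian ::
  "('m::{t2_space,second_countable_topology}, 'e::euclidean_space) atlas \<Rightarrow> nat
     \<Rightarrow> ('m \<Rightarrow> 'm tvec \<Rightarrow> 'm tvec) \<Rightarrow> 'm vfield \<Rightarrow> ('m \<Rightarrow> 'm tvec \<Rightarrow> real)
     \<Rightarrow> ('m \<Rightarrow> 'm tvec \<Rightarrow> 'm tvec \<Rightarrow> real) \<Rightarrow> bool" where
  "nearly_sasakian A n \<phi> \<xi> \<eta> g \<longleftrightarrow> almost_contact_metric A n \<phi> \<xi> \<eta> g \<and>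
     (\<exists>D. levi_civita A g D \<and>
       (\<forall>X Y. vector_field A X \<longrightarrow> vector_field A Y \<longrightarrow>
          cov_endo D \<phi> X Y + cov_endo D \<phi> Y X =
            fscale (\<lambda>p. 2 * ap2 g X Y p) \<xi> - fscale (ap1 \<eta> X) Y - fscale (ap1 \<eta> Y) X))"

end

(* Let N be the Levi-Civita connection. If D is metric with skew torsion, then H = D - N is
   alternating. If D also parallelizes phi and xi, then the nearly Sasakian identity evaluated at
   (X, xi) yields N_X xi = - phi X. Hence d eta (X, Y) = 2 g (X, phi Y), and d (d eta) = 0 says that
   the cyclic sum of g (Y, (N_X phi) Z) vanishes. The nearly Sasakian identity and the skew symmetry
   of N phi make the defect of the Sasakian identity an alternating 3-tensor, and its cyclic sum is
   the one just computed; so the defect is zero. Conversely, on a Sasakian manifold the connection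
   N_X Y + eta(Y) phi X - eta(X) phi Y + g(X, phi Y) xi has all required properties.

   Every identity is proved for global vector fields; a field is zero as soon as it is orthogonal to
   itself, so no extension of tangent vectors to vector fields is needed. *)

theory Submission imports Defs begin

section \<open>Smooth functions\<close>

lemma Ck_on_Suc_imp: "Ck_on (Suc k) S f \<Longrightarrow> Ck_on k S f"
proof (induction k arbitrary: f)
  case 0
  then show ?case
    by (auto intro!: continuous_at_imp_continuous_on differentiable_imp_continuous_within)
next
  case (Suc k)
  then show ?case by (meson Ck_on.simps(2))
qed

text \<open>On an open \<open>S\<close>, agreement on \<open>S\<close> is agreement near each of its
  points, so the full derivatives coincide there and the induction can proceed.\<close>

lemma Ck_on_cong:
  assumes "open S" "\<And>x. x \<in> S \<Longrightarrow> f x = h x" "Ck_on k S f"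
  shows "Ck_on k S h"
  using assms
proof (induction k arbitrary: f h)
  case 0
  then show ?case by (simp cong: continuous_on_cong)
next
  case (Suc k)
  have d: "(h has_derivative frechet_derivative f (at x)) (at x)" if "x \<in> S" for x
    using Suc.prems that
    by (metis Ck_on.simps(2) frechet_derivative_works has_derivative_transform_within_open)
  then have "frechet_derivative f (at x) = frechet_derivative h (at x)" if "x \<in> S" for x
    using that frechet_derivative_at by blast
  then have "Ck_on k S (\<lambda>x. frechet_derivative h (at x) v)" for v
    using Suc.IH[of "\<lambda>x. frechet_derivative f (at x) v"] Suc.prems by auto
  then show ?case using d differentiable_def by (metis Ck_on.simps(2))
qed

lemma Ck_on_const: "Ck_on k S (\<lambda>x. c)"
  by (induction k arbitrary: c) (simp_all add: frechet_derivative_const)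

lemma Ck_on_add:
  assumes "open S" "Ck_on k S f" "Ck_on k S h"
  shows "Ck_on k S (\<lambda>x. f x + h x)"
  using assms
proof (induction k arbitrary: f h)
  case 0
  then show ?case by (simp add: continuous_on_add)
next
  case (Suc k)
  have d: "((\<lambda>x. f x + h x) has_derivative
      (\<lambda>v. frechet_derivative f (at x) v + frechet_derivative h (at x) v)) (at x)" if "x \<in> S" for x
    using Suc.prems that by (auto intro!: has_derivative_add simp: frechet_derivative_works[symmetric])
  have "Ck_on k S (\<lambda>x. frechet_derivative (\<lambda>x. f x + h x) (at x) v)" for v
  proof (rule Ck_on_cong[OF Suc.prems(1)])
    show "Ck_on k S (\<lambda>x. frechet_derivative f (at x) v + frechet_derivative h (at x) v)"
      using Suc by simp
  qed (simp add: frechet_derivative_at[OF d, symmetric])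
  then show ?case using d differentiable_def by (metis Ck_on.simps(2))
qed

lemma Ck_on_mult:
  fixes f h :: "'a::euclidean_space \<Rightarrow> real"
  assumes "open S" "Ck_on k S f" "Ck_on k S h"
  shows "Ck_on k S (\<lambda>x. f x * h x)"
  using assms
proof (induction k arbitrary: f h)
  case 0
  then show ?case by (simp add: continuous_on_mult)
next
  case (Suc k)
  have d: "((\<lambda>x. f x * h x) has_derivative
      (\<lambda>v. f x * frechet_derivative h (at x) v + frechet_derivative f (at x) v * h x)) (at x)"
    if "x \<in> S" for x
    using Suc.prems that by (auto intro!: has_derivative_mult simp: frechet_derivative_works[symmetric])
  have "Ck_on k S (\<lambda>x. frechet_derivative (\<lambda>x. f x * h x) (at x) v)" for v
  proof (rule Ck_on_cong[OF Suc.prems(1)])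
    \<comment> \<open>The product rule leaves one factor undifferentiated in each summand, so
      \<open>f\<close> and \<open>h\<close> themselves are needed at order \<open>k\<close>.\<close>
    have "Ck_on k S f" "Ck_on k S h"
      using Suc.prems Ck_on_Suc_imp by blast+
    then show "Ck_on k S (\<lambda>x. f x * frechet_derivative h (at x) v + frechet_derivative f (at x) v * h x)"
      using Suc by (intro Ck_on_add) simp_all
  qed (simp add: frechet_derivative_at[OF d, symmetric])
  then show ?case using d differentiable_def by (metis Ck_on.simps(2))
qed

locale smooth_structure =
  fixes A :: "('m::{t2_space,second_countable_topology}, 'e::euclidean_space) atlas"
  assumes atlas: "smooth_atlas A"
begin

lemma open_chart_image: "(U, \<psi>) \<in> A \<Longrightarrow> open (\<psi> ` U)"
  using atlas unfolding smooth_atlas_def by blast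

lemma smooth_fun_const: "smooth_fun A (\<lambda>p. c)"
  by (auto simp: smooth_fun_def smooth_on_def comp_def Ck_on_const)

lemma smooth_fun_zero: "smooth_fun A 0"
  using smooth_fun_const[of 0] by (simp add: zero_fun_def)

lemma smooth_fun_add: "smooth_fun A f \<Longrightarrow> smooth_fun A h \<Longrightarrow> smooth_fun A (f + h)"
  using open_chart_image
  by (force simp: smooth_fun_def smooth_on_def comp_def plus_fun_def intro!: Ck_on_add)

lemma smooth_fun_mult: "smooth_fun A f \<Longrightarrow> smooth_fun A h \<Longrightarrow> smooth_fun A (f * h)"
  using open_chart_image
  by (force simp: smooth_fun_def smooth_on_def comp_def times_fun_def intro!: Ck_on_mult)

lemma smooth_fun_scale: "smooth_fun A f \<Longrightarrow> smooth_fun A (\<lambda>p. c * f p)"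
  using smooth_fun_mult[OF smooth_fun_const[of c], of f] by (simp add: times_fun_def)

lemma smooth_fun_uminus: "smooth_fun A f \<Longrightarrow> smooth_fun A (- f)"
  using smooth_fun_scale[of f "-1"] by (simp add: fun_Compl_def)

lemma smooth_fun_diff: "smooth_fun A f \<Longrightarrow> smooth_fun A h \<Longrightarrow> smooth_fun A (f - h)"
  using smooth_fun_add[OF _ smooth_fun_uminus, of f h] by simp

section \<open>Tangent vectors and vector fields\<close>

abbreviation T :: "'m \<Rightarrow> 'm tvec set" where "T p \<equiv> tangent_space A p"
abbreviation V :: "'m vfield \<Rightarrow> bool" where "V X \<equiv> vector_field A X"

lemma tangent_add: "v \<in> T p \<Longrightarrow> w \<in> T p \<Longrightarrow> v + w \<in> T p"
  by (auto simp: tangent_space_def algebra_simps)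

lemma tangent_scale: "v \<in> T p \<Longrightarrow> tscale c v \<in> T p"
  by (auto simp: tangent_space_def tscale_def algebra_simps)

lemma tangent_zero: "0 \<in> T p"
  by (auto simp: tangent_space_def)

lemma uminus_eq_tscale: "- v = tscale (-1) v"
  by (auto simp: tscale_def)

lemma tangent_uminus: "v \<in> T p \<Longrightarrow> - v \<in> T p"
  by (simp add: uminus_eq_tscale tangent_scale)

lemma tangent_diff: "v \<in> T p \<Longrightarrow> w \<in> T p \<Longrightarrow> v - w \<in> T p"
  using tangent_add[OF _ tangent_uminus, of v p w] by simp

lemma tangent_map_add: "v \<in> T p \<Longrightarrow> smooth_fun A f \<Longrightarrow> smooth_fun A h \<Longrightarrow> v (f + h) = v f + v h"
  by (simp add: tangent_space_def)

lemma tangent_map_uminus: "v \<in> T p \<Longrightarrow> smooth_fun A f \<Longrightarrow> v (- f) = - v f"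
proof -
  assume v: "v \<in> T p" and f: "smooth_fun A f"
  have "v (\<lambda>q. - 1 * f q) = - 1 * v f"
    using v f unfolding tangent_space_def by blast
  then show ?thesis by (simp add: fun_Compl_def)
qed

lemma tangent_map_diff: "v \<in> T p \<Longrightarrow> smooth_fun A f \<Longrightarrow> smooth_fun A h \<Longrightarrow> v (f - h) = v f - v h"
  using tangent_map_add[of v p f "- h"] by (simp add: smooth_fun_uminus tangent_map_uminus)

lemma tangent_map_mult:
  "v \<in> T p \<Longrightarrow> smooth_fun A f \<Longrightarrow> smooth_fun A h \<Longrightarrow> v (f * h) = v f * h p + f p * v h"
  by (simp add: tangent_space_def)

lemma tangent_map_scale: "v \<in> T p \<Longrightarrow> smooth_fun A f \<Longrightarrow> v (\<lambda>q. c * f q) = c * v f"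
  by (simp add: tangent_space_def)

lemma tangent_map_non_smooth: "v \<in> T p \<Longrightarrow> \<not> smooth_fun A f \<Longrightarrow> v f = 0"
  by (simp add: tangent_space_def)

lemma tangent_map_zero: "v \<in> T p \<Longrightarrow> v 0 = 0"
  using tangent_map_add[of v p 0 0] smooth_fun_zero by simp

lemma tangent_map_const: "v \<in> T p \<Longrightarrow> v (\<lambda>q. c) = 0"
proof -
  assume v: "v \<in> T p"
  have 1: "smooth_fun A 1" using smooth_fun_const[of 1] by (simp add: one_fun_def)
  \<comment> \<open>The Leibniz rule for 1 = 1 * 1 reads v 1 = v 1 + v 1.\<close>
  have "v 1 = 0" using tangent_map_mult[OF v 1 1] by simp
  then show ?thesis using tangent_map_scale[OF v 1, of c] by simp
qed

lemma vector_field_tangent: "V X \<Longrightarrow> X p \<in> T p"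
  by (simp add: vector_field_def)

lemma smooth_deriv_along: "V X \<Longrightarrow> smooth_fun A f \<Longrightarrow> smooth_fun A (deriv_along X f)"
  by (simp add: vector_field_def)

lemma vector_field_add: "V X \<Longrightarrow> V Y \<Longrightarrow> V (X + Y)"
proof -
  have "deriv_along (X + Y) f = deriv_along X f + deriv_along Y f" for f
    by (auto simp: deriv_along_def)
  then show "V X \<Longrightarrow> V Y \<Longrightarrow> V (X + Y)"
    by (simp add: vector_field_def tangent_add smooth_fun_add)
qed

lemma vector_field_fscale: "smooth_fun A f \<Longrightarrow> V X \<Longrightarrow> V (fscale f X)"
proof -
  have "deriv_along (fscale f X) h = f * deriv_along X h" for h
    by (auto simp: deriv_along_def fscale_def tscale_def)
  then show "smooth_fun A f \<Longrightarrow> V X \<Longrightarrow> V (fscale f X)"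
    by (simp add: vector_field_def tangent_scale smooth_fun_mult fscale_def)
qed

lemma uminus_eq_fscale: "- X = fscale (\<lambda>p. -1) X"
  by (intro ext) (simp add: fscale_def tscale_def)

lemma vector_field_uminus: "V X \<Longrightarrow> V (- X)"
  by (simp add: uminus_eq_fscale vector_field_fscale smooth_fun_const)

lemma vector_field_diff: "V X \<Longrightarrow> V Y \<Longrightarrow> V (X - Y)"
  using vector_field_add[OF _ vector_field_uminus, of X Y] by simp

lemma vector_field_zero: "V 0"
  by (auto simp: vector_field_def tangent_zero deriv_along_def smooth_fun_const)

lemmas vector_field_intros = vector_field_add vector_field_diff vector_field_uminus
  vector_field_fscale vector_field_zero
lemmas tangent_intros = tangent_add tangent_diff tangent_uminus tangent_scale tangent_zero
  vector_field_tangent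

lemma deriv_along_lie_bracket:
  "deriv_along (lie_bracket X Y) f = deriv_along X (deriv_along Y f) - deriv_along Y (deriv_along X f)"
  by (auto simp: deriv_along_def lie_bracket_def)

lemma deriv_along_mult:
  "V X \<Longrightarrow> smooth_fun A f \<Longrightarrow> smooth_fun A h \<Longrightarrow>
    deriv_along X (f * h) = deriv_along X f * h + f * deriv_along X h"
  by (auto simp: deriv_along_def tangent_map_mult[OF vector_field_tangent])

lemma deriv_along_add:
  "V X \<Longrightarrow> smooth_fun A f \<Longrightarrow> smooth_fun A h \<Longrightarrow>
    deriv_along X (f + h) = deriv_along X f + deriv_along X h"
  by (auto simp: deriv_along_def tangent_map_add[OF vector_field_tangent])

lemma deriv_along_scale:
  "V X \<Longrightarrow> smooth_fun A f \<Longrightarrow> deriv_along X (\<lambda>p. c * f p) = (\<lambda>p. c * deriv_along X f p)"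
  by (auto simp: deriv_along_def tangent_map_scale[OF vector_field_tangent])

lemma deriv_along_non_smooth: "V X \<Longrightarrow> \<not> smooth_fun A f \<Longrightarrow> deriv_along X f = 0"
  by (auto simp: deriv_along_def tangent_map_non_smooth[OF vector_field_tangent])

text \<open>In X (Y (f * h)) the cross terms X f * Y h + Y f * X h are symmetric in X and Y, so they
  cancel in the commutator, which is again a derivation. On non-smooth functions both summands of
  the bracket are 0 by the convention for tangent vectors.\<close>

lemma vector_field_lie_bracket:
  assumes X: "V X" and Y: "V Y"
  shows "V (lie_bracket X Y)"
  unfolding vector_field_def
proof (intro conjI allI impI)
  fix f assume "smooth_fun A f"
  then show "smooth_fun A (deriv_along (lie_bracket X Y) f)"
    by (simp add: deriv_along_lie_bracket smooth_fun_diff smooth_deriv_along X Y)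
next
  fix p
  note [simp] = X Y smooth_deriv_along smooth_fun_mult deriv_along_mult deriv_along_add
    deriv_along_scale deriv_along_non_smooth
    tangent_map_add[OF vector_field_tangent] tangent_map_mult[OF vector_field_tangent]
    tangent_map_scale[OF vector_field_tangent] tangent_map_zero[OF vector_field_tangent]
  show "lie_bracket X Y p \<in> T p"
    unfolding tangent_space_def
    by (auto simp: lie_bracket_def algebra_simps) (simp add: deriv_along_def)
qed

lemma jacobi:
  assumes X: "V X" and Y: "V Y" and Z: "V Z"
  shows "lie_bracket (lie_bracket X Y) Z p + lie_bracket (lie_bracket Y Z) X p
    + lie_bracket (lie_bracket Z X) Y p = 0"
proof
  fix f
  show "(lie_bracket (lie_bracket X Y) Z p + lie_bracket (lie_bracket Y Z) X p
    + lie_bracket (lie_bracket Z X) Y p) f = 0 f"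
  proof (cases "smooth_fun A f")
    case True
    then show ?thesis
      by (simp add: lie_bracket_def deriv_along_lie_bracket[unfolded lie_bracket_def]
          tangent_map_diff[OF vector_field_tangent] smooth_deriv_along X Y Z)
  next
    case False
    \<comment> \<open>The brackets cannot be expanded by additivity on a non-smooth function;
      instead each nested bracket is a vector field and takes the default value 0.\<close>
    have "V (lie_bracket (lie_bracket X Y) Z)" "V (lie_bracket (lie_bracket Y Z) X)"
      "V (lie_bracket (lie_bracket Z X) Y)"
      by (intro vector_field_lie_bracket X Y Z)+
    then show ?thesis
      using False by (simp add: tangent_map_non_smooth[OF vector_field_tangent])
  qed
qed

section \<open>One-forms and metrics\<close>

text \<open>The exterior derivative in the convention without the factor 1/2, as a function of
  global vector fields.\<close>

definition ext_deriv :: "('m \<Rightarrow> 'm tvec \<Rightarrow> real) \<Rightarrow> 'm vfield \<Rightarrow> 'm vfield \<Rightarrow> 'm \<Rightarrow> real" where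
  "ext_deriv \<eta> X Y = deriv_along X (ap1 \<eta> Y) - deriv_along Y (ap1 \<eta> X) - ap1 \<eta> (lie_bracket X Y)"

text \<open>This is d (d eta) = 0, with the bracket terms moved to the right. After expansion the
  second derivatives and the derivatives of \<open>\<eta>\<close> on brackets agree on both sides;
  what remains is \<open>\<eta>\<close> applied to the Jacobi sum.\<close>

lemma ext_deriv_closed:
  assumes \<eta>: "one_form A \<eta>" and X: "V X" and Y: "V Y" and Z: "V Z"
  shows "X p (ext_deriv \<eta> Y Z) + Y p (ext_deriv \<eta> Z X) + Z p (ext_deriv \<eta> X Y)
    = ext_deriv \<eta> (lie_bracket X Y) Z p + ext_deriv \<eta> (lie_bracket Y Z) X p
      + ext_deriv \<eta> (lie_bracket Z X) Y p"
proof -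
  have sm: "smooth_fun A (ap1 \<eta> W)" if "V W" for W
    using \<eta> that by (simp add: one_form_def)
  have add: "\<eta> p (v + w) = \<eta> p v + \<eta> p w" if "v \<in> T p" "w \<in> T p" for v w
    using \<eta> that by (simp add: one_form_def)
  have zero: "\<eta> p 0 = 0"
    using add[of 0 0] tangent_zero by simp
  note V = X Y Z vector_field_lie_bracket
  have left: "P p (ext_deriv \<eta> Q R)
      = P p (deriv_along Q (ap1 \<eta> R)) - P p (deriv_along R (ap1 \<eta> Q)) - P p (ap1 \<eta> (lie_bracket Q R))"
    if "V P" "V Q" "V R" for P Q R
    by (simp add: ext_deriv_def that V tangent_map_diff[OF vector_field_tangent] sm
        smooth_deriv_along smooth_fun_diff)
  have right: "ext_deriv \<eta> (lie_bracket P Q) R p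
      = P p (deriv_along Q (ap1 \<eta> R)) - Q p (deriv_along P (ap1 \<eta> R))
        - R p (ap1 \<eta> (lie_bracket P Q)) - \<eta> p (lie_bracket (lie_bracket P Q) R p)" for P Q R
    by (simp add: ext_deriv_def lie_bracket_def ap1_def deriv_along_def)
  have "\<eta> p (lie_bracket (lie_bracket X Y) Z p) + \<eta> p (lie_bracket (lie_bracket Y Z) X p)
      + \<eta> p (lie_bracket (lie_bracket Z X) Y p) = 0"
    using jacobi[OF X Y Z, of p] zero by (simp add: add[symmetric] V tangent_intros)
  then show ?thesis
    by (simp add: left right X Y Z)
qed

section \<open>Linear connections and metric compatibility\<close>

lemma connection_vector_field: "linear_connection A D \<Longrightarrow> V X \<Longrightarrow> V Y \<Longrightarrow> V (D X Y)"
  by (simp add: linear_connection_def)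

lemma connection_add_left:
  "linear_connection A D \<Longrightarrow> V X \<Longrightarrow> V Y \<Longrightarrow> V Z \<Longrightarrow> D (X + Y) Z = D X Z + D Y Z"
  by (simp add: linear_connection_def)

lemma connection_add_right:
  "linear_connection A D \<Longrightarrow> V X \<Longrightarrow> V Y \<Longrightarrow> V Z \<Longrightarrow> D X (Y + Z) = D X Y + D X Z"
  by (simp add: linear_connection_def)

lemma connection_fscale_left:
  "linear_connection A D \<Longrightarrow> smooth_fun A f \<Longrightarrow> V X \<Longrightarrow> V Y \<Longrightarrow> D (fscale f X) Y = fscale f (D X Y)"
  by (simp add: linear_connection_def)

lemma connection_fscale_right:
  "linear_connection A D \<Longrightarrow> smooth_fun A f \<Longrightarrow> V X \<Longrightarrow> V Y \<Longrightarrow>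
    D X (fscale f Y) = fscale (deriv_along X f) Y + fscale f (D X Y)"
  by (simp add: linear_connection_def)

lemma connection_zero_right: "linear_connection A D \<Longrightarrow> V X \<Longrightarrow> D X 0 = 0"
  using connection_add_right[of D X 0 0] vector_field_zero by simp

lemma metric_deriv:
  assumes "parallel_metric A D g" "V X" "V Y" "V Z"
  shows "X p (ap2 g Y Z) = g p (D X Y p) (Z p) + g p (Y p) (D X Z p)"
proof -
  have "cov_metric D g X Y Z p = 0"
    using assms by (simp add: parallel_metric_def)
  then show ?thesis
    by (simp add: cov_metric_def deriv_along_def ap2_def)
qed

end

section \<open>Riemannian metrics and comparison with the Levi-Civita connection\<close>

locale riemannian = smooth_structure A
  for A :: "('m::{t2_space,second_countable_topology}, 'e::euclidean_space) atlas" +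
  fixes g :: "'m \<Rightarrow> 'm tvec \<Rightarrow> 'm tvec \<Rightarrow> real"
  assumes metric: "riemannian_metric A g"
begin

lemma g_sym: "v \<in> T p \<Longrightarrow> w \<in> T p \<Longrightarrow> g p v w = g p w v"
  using metric unfolding riemannian_metric_def by blast

lemma g_add_left: "u \<in> T p \<Longrightarrow> v \<in> T p \<Longrightarrow> w \<in> T p \<Longrightarrow> g p (u + v) w = g p u w + g p v w"
  using metric by (simp add: riemannian_metric_def)

lemma g_scale_left: "v \<in> T p \<Longrightarrow> w \<in> T p \<Longrightarrow> g p (tscale c v) w = c * g p v w"
  using metric by (simp add: riemannian_metric_def)

lemma g_add_right: "u \<in> T p \<Longrightarrow> v \<in> T p \<Longrightarrow> w \<in> T p \<Longrightarrow> g p w (u + v) = g p w u + g p w v"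
  by (metis g_add_left g_sym tangent_add)

lemma g_scale_right: "v \<in> T p \<Longrightarrow> w \<in> T p \<Longrightarrow> g p w (tscale c v) = c * g p w v"
  by (metis g_scale_left g_sym tangent_scale)

lemma g_uminus_left: "v \<in> T p \<Longrightarrow> w \<in> T p \<Longrightarrow> g p (- v) w = - g p v w"
  by (simp add: uminus_eq_tscale g_scale_left)

lemma g_uminus_right: "v \<in> T p \<Longrightarrow> w \<in> T p \<Longrightarrow> g p w (- v) = - g p w v"
  by (simp add: uminus_eq_tscale g_scale_right)

lemma g_diff_left: "u \<in> T p \<Longrightarrow> v \<in> T p \<Longrightarrow> w \<in> T p \<Longrightarrow> g p (u - v) w = g p u w - g p v w"
  using g_add_left[of u p "- v" w] by (simp add: g_uminus_left tangent_uminus)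

lemma g_diff_right: "u \<in> T p \<Longrightarrow> v \<in> T p \<Longrightarrow> w \<in> T p \<Longrightarrow> g p w (u - v) = g p w u - g p w v"
  using g_add_right[of u p "- v" w] by (simp add: g_uminus_right tangent_uminus)

lemma g_zero_right: "w \<in> T p \<Longrightarrow> g p w 0 = 0"
  using g_add_right[of 0 p 0 w] tangent_zero by simp

lemmas g_simps = g_add_left g_add_right g_scale_left g_scale_right g_uminus_left g_uminus_right
  g_diff_left g_diff_right g_zero_right

lemma g_eq_0D: "v \<in> T p \<Longrightarrow> g p v v = 0 \<Longrightarrow> v = 0"
  using metric unfolding riemannian_metric_def by (metis less_irrefl)

text \<open>The tests Z = X and Z = Y together show that X - Y has norm zero at every point.\<close>

lemma vector_field_eqI:
  assumes "V X" "V Y" and eq: "\<And>Z p. V Z \<Longrightarrow> g p (X p) (Z p) = g p (Y p) (Z p)"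
  shows "X = Y"
proof
  fix p
  have T: "X p \<in> T p" "Y p \<in> T p"
    using assms by (simp_all add: tangent_intros)
  have "g p (X p - Y p) (X p - Y p) = 0"
    using eq[of X p] eq[of Y p] assms(1,2) by (simp add: g_diff_left g_diff_right T tangent_diff)
  then have "X p - Y p = 0"
    by (rule g_eq_0D[rotated]) (simp add: T tangent_diff)
  then show "X p = Y p" by simp
qed

lemma smooth_metric: "V X \<Longrightarrow> V Y \<Longrightarrow> smooth_fun A (ap2 g X Y)"
  using metric by (simp add: riemannian_metric_def)

lemma lie_bracket_levi_civita:
  assumes "levi_civita A g N" "V X" "V Y"
  shows "lie_bracket X Y = N X Y - N Y X"
  using assms by (simp add: levi_civita_def torsion_def)

text \<open>Lowered with \<open>g\<close>, the difference H = D - N is skew in its last two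
  arguments because both connections are metric. As N is torsion-free, antisymmetrizing H in its
  first two arguments gives the torsion of D, whose skew symmetry then passes to H.\<close>

lemma contorsion_alternating:
  assumes N: "levi_civita A g N" and D: "linear_connection A D" "parallel_metric A D g"
    and skew: "skew_torsion A g D" and X: "V X" and Y: "V Y"
  shows "D X Y - N X Y = - (D Y X - N Y X)"
proof (rule vector_field_eqI)
  have N': "linear_connection A N" "parallel_metric A N g"
    using N by (simp_all add: levi_civita_def)
  note closed = connection_vector_field[OF D(1)] connection_vector_field[OF N'(1)]
    vector_field_intros tangent_intros
  show "V (D X Y - N X Y)" "V (- (D Y X - N Y X))"
    by (simp_all add: closed X Y del: minus_diff_eq)
  define a where "a P Q R p = g p (D P Q p - N P Q p) (R p)" for P Q R p
  have metric_skew: "a P Q R p = - a P R Q p" if "V P" "V Q" "V R" for P Q R p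
    using metric_deriv[OF D(2) that, of p] metric_deriv[OF N'(2) that, of p]
    by (simp add: a_def g_diff_left closed that g_sym[of "Q p"])
  have torsion: "ap2 g (torsion D P Q) R p = a P Q R p - a Q P R p" if "V P" "V Q" "V R" for P Q R p
    by (simp add: a_def ap2_def torsion_def lie_bracket_levi_civita[OF N] g_simps closed that)
  have torsion_skew: "ap2 g (torsion D P Q) R p = - ap2 g (torsion D P R) Q p"
    if "V P" "V Q" "V R" for P Q R p
    using skew that unfolding skew_torsion_def by (metis uminus_apply)
  fix Z p assume Z: "V Z"
  \<comment> \<open>Combined with \<open>metric_skew\<close>, skew torsion at (X, Y, Z) gives a Z X
    Y = - a Y X Z, and at (Y, X, Z) it gives a Z X Y = a X Y Z.\<close>
  have "a X Y Z p = - a Y X Z p"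
    using torsion_skew[OF X Y Z, of p] torsion_skew[OF Y X Z, of p] torsion_skew[OF Z X Y, of p]
      metric_skew[OF X Y Z, of p] metric_skew[OF Y X Z, of p] metric_skew[OF Z X Y, of p]
    by (simp add: torsion X Y Z)
  then show "g p ((D X Y - N X Y) p) (Z p) = g p ((- (D Y X - N Y X)) p) (Z p)"
    by (simp add: a_def g_simps closed X Y Z)
qed

end

section \<open>Almost contact metric structures\<close>

lemma tscale_apply: "tscale c v f = c * v f"
  by (simp add: tscale_def)

lemma tscale_zero: "tscale c 0 = 0"
  by (auto simp: tscale_def)

lemma fscale_apply: "fscale f X p = tscale (f p) (X p)"
  by (simp add: fscale_def)

lemma ap1_apply: "ap1 F X p = F p (X p)"
  by (simp add: ap1_def)

lemma ap2_apply: "ap2 F X Y p = F p (X p) (Y p)"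
  by (simp add: ap2_def)

lemmas apply_simps = tscale_apply fscale_apply ap1_apply ap2_apply

locale almost_contact =
  fixes A :: "('m::{t2_space,second_countable_topology}, 'e::euclidean_space) atlas"
    and n :: nat
    and \<phi> :: "'m \<Rightarrow> 'm tvec \<Rightarrow> 'm tvec"
    and \<xi> :: "'m vfield"
    and \<eta> :: "'m \<Rightarrow> 'm tvec \<Rightarrow> real"
    and g :: "'m \<Rightarrow> 'm tvec \<Rightarrow> 'm tvec \<Rightarrow> real"
  assumes acm: "almost_contact_metric A n \<phi> \<xi> \<eta> g"

sublocale almost_contact \<subseteq> riemannian A g
  using acm by unfold_locales (simp_all add: almost_contact_metric_def smooth_manifold_def)

context almost_contact
begin

lemma endo_phi: "endo_field A \<phi>" and vector_field_xi: "V \<xi>" and one_form_eta: "one_form A \<eta>"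
  using acm by (simp_all add: almost_contact_metric_def)

lemma phi_tangent: "v \<in> T p \<Longrightarrow> \<phi> p v \<in> T p"
  and phi_add: "v \<in> T p \<Longrightarrow> w \<in> T p \<Longrightarrow> \<phi> p (v + w) = \<phi> p v + \<phi> p w"
  and phi_scale: "v \<in> T p \<Longrightarrow> \<phi> p (tscale c v) = tscale c (\<phi> p v)"
  and vector_field_phi: "V X \<Longrightarrow> V (ap1 \<phi> X)"
  using endo_phi by (simp_all add: endo_field_def)

lemma phi_uminus: "v \<in> T p \<Longrightarrow> \<phi> p (- v) = - \<phi> p v"
  by (simp add: uminus_eq_tscale phi_scale)

lemma phi_diff: "v \<in> T p \<Longrightarrow> w \<in> T p \<Longrightarrow> \<phi> p (v - w) = \<phi> p v - \<phi> p w"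
  using phi_add[of v p "- w"] by (simp add: phi_uminus tangent_uminus)

lemma phi_zero: "\<phi> p 0 = 0"
  using phi_add[of 0 p 0] by (simp add: tangent_zero)

lemma eta_add: "v \<in> T p \<Longrightarrow> w \<in> T p \<Longrightarrow> \<eta> p (v + w) = \<eta> p v + \<eta> p w"
  and eta_scale: "v \<in> T p \<Longrightarrow> \<eta> p (tscale c v) = c * \<eta> p v"
  and smooth_eta: "V X \<Longrightarrow> smooth_fun A (ap1 \<eta> X)"
  using one_form_eta by (simp_all add: one_form_def)

lemma phi_phi: "v \<in> T p \<Longrightarrow> \<phi> p (\<phi> p v) = - v + tscale (\<eta> p v) (\<xi> p)"
  and eta_xi: "\<eta> p (\<xi> p) = 1"
  and g_phi_phi: "v \<in> T p \<Longrightarrow> w \<in> T p \<Longrightarrow> g p (\<phi> p v) (\<phi> p w) = g p v w - \<eta> p v * \<eta> p w"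
  using acm by (simp_all add: almost_contact_metric_def)

lemma xi_tangent: "\<xi> p \<in> T p"
  by (simp add: vector_field_xi vector_field_tangent)

text \<open>With \<open>c = \<eta>(\<phi> \<xi>)\<close>, \<open>\<phi>\<^sup>2 \<xi> = 0\<close> gives \<open>\<phi> \<xi> = c \<xi>\<close>, hence \<open>c\<^sup>2 \<xi> = 0\<close>.\<close>

lemma phi_xi: "\<phi> p (\<xi> p) = 0"
proof -
  define c where "c = \<eta> p (\<phi> p (\<xi> p))"
  have one: "tscale 1 v = v" for v :: "'m tvec"
    by (simp add: tscale_def)
  have sq: "\<phi> p (\<phi> p (\<xi> p)) = 0"
    by (simp add: phi_phi xi_tangent eta_xi one)
  then have "0 = \<phi> p (\<phi> p (\<phi> p (\<xi> p)))"
    by (simp add: phi_zero)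
  also have "\<dots> = - \<phi> p (\<xi> p) + tscale c (\<xi> p)"
    by (simp add: phi_phi[of "\<phi> p (\<xi> p)"] phi_tangent xi_tangent c_def)
  finally have c: "\<phi> p (\<xi> p) = tscale c (\<xi> p)"
    by (metis add_eq_0_iff add.commute minus_minus)
  have "\<eta> p (\<phi> p (\<phi> p (\<xi> p))) = c * c"
    unfolding c by (simp add: phi_scale c eta_scale eta_xi xi_tangent tangent_scale)
  moreover have "\<eta> p 0 = 0"
    using eta_scale[OF xi_tangent, of p 0] by (simp add: tscale_def zero_fun_def)
  ultimately have "c = 0" using sq by simp
  then show ?thesis using c by (auto simp: tscale_def)
qed

lemma phi_xi_field: "ap1 \<phi> \<xi> = 0"
  by (intro ext) (simp add: ap1_apply phi_xi)

text \<open>Computing the cube of \<phi> as \<phi> after its square and as the square after \<phi>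
  leaves \<eta>(\<phi> v) \<xi> = 0.\<close>

lemma eta_phi: "v \<in> T p \<Longrightarrow> \<eta> p (\<phi> p v) = 0"
proof -
  assume v: "v \<in> T p"
  have "\<phi> p (\<phi> p (\<phi> p v)) = - \<phi> p v"
    unfolding phi_phi[OF v]
    by (simp only: phi_add phi_uminus phi_scale phi_xi tscale_zero v tangent_intros xi_tangent add_0_right)
  then have "tscale (\<eta> p (\<phi> p v)) (\<xi> p) = 0"
    using phi_phi[of "\<phi> p v" p] by (simp add: phi_tangent v)
  then have "\<eta> p (tscale (\<eta> p (\<phi> p v)) (\<xi> p)) = \<eta> p (tscale 0 (\<xi> p))"
    by (simp add: tscale_def zero_fun_def)
  then show ?thesis by (simp add: eta_scale xi_tangent eta_xi)
qed

text \<open>Compatibility of \<open>g\<close> and \<open>\<phi>\<close> at (v, \<xi>) has left side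
  0, since \<phi> \<xi> = 0. So \<eta> is the metric dual of \<xi>.\<close>

lemma g_xi_right: "v \<in> T p \<Longrightarrow> g p v (\<xi> p) = \<eta> p v"
  using g_phi_phi[of v p "\<xi> p"] by (simp add: phi_xi xi_tangent eta_xi g_zero_right phi_tangent)

lemma g_xi_left: "v \<in> T p \<Longrightarrow> g p (\<xi> p) v = \<eta> p v"
  using g_sym g_xi_right xi_tangent by metis

text \<open>Compatibility at (v, \<phi> w): expanding \<phi> (\<phi> w) leaves only \<eta> terms
  that vanish by \<open>eta_phi\<close>.\<close>

lemma phi_skew: "v \<in> T p \<Longrightarrow> w \<in> T p \<Longrightarrow> g p (\<phi> p v) w = - g p v (\<phi> p w)"
  using g_phi_phi[of v p "\<phi> p w"]
  by (simp add: phi_phi phi_tangent eta_phi g_simps tangent_intros xi_tangent g_xi_right)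

text \<open>Skew symmetry of the fundamental 2-form g(v, \<phi> w). As a rewrite rule it is used
  with its first vector fixed, since in general it would apply to its own result.\<close>

lemma phi_skew_right: "v \<in> T p \<Longrightarrow> w \<in> T p \<Longrightarrow> g p v (\<phi> p w) = - g p w (\<phi> p v)"
  using phi_skew[of w p v] by (simp add: g_sym[of v] phi_tangent)

lemma phi_skew_fields: "V X \<Longrightarrow> V Y \<Longrightarrow> ap2 g (ap1 \<phi> X) Y = - ap2 g X (ap1 \<phi> Y)"
  by (intro ext) (simp add: apply_simps phi_skew tangent_intros)

lemma eta_eq_metric: "V X \<Longrightarrow> ap1 \<eta> X = ap2 g X \<xi>"
  by (intro ext) (simp add: apply_simps g_xi_right tangent_intros)

lemmas structure_closed = vector_field_intros vector_field_phi vector_field_xi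
  tangent_intros phi_tangent xi_tangent

lemmas structure_simps = phi_add phi_diff phi_scale phi_uminus phi_zero phi_xi phi_phi
  eta_add eta_scale eta_phi eta_xi g_xi_left g_xi_right

section \<open>Covariant derivatives of phi and xi\<close>

lemma cov_endo_apply: "cov_endo D \<phi> X Y p = D X (ap1 \<phi> Y) p - \<phi> p (D X Y p)"
  by (simp add: cov_endo_def ap1_def)

lemma vector_field_cov_endo:
  "linear_connection A D \<Longrightarrow> V X \<Longrightarrow> V Y \<Longrightarrow> V (cov_endo D \<phi> X Y)"
  by (simp add: cov_endo_def structure_closed connection_vector_field)

text \<open>Differentiate g(\<phi> Y, Z) = - g(Y, \<phi> Z) along X; since N is metric, the terms
  with N X Y and N X Z cancel by skewness of \<phi>.\<close>

lemma cov_endo_skew: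
  assumes N: "linear_connection A N" "parallel_metric A N g" and X: "V X" and Y: "V Y" and Z: "V Z"
  shows "g p (cov_endo N \<phi> X Y p) (Z p) = - g p (cov_endo N \<phi> X Z p) (Y p)"
proof -
  note closed = connection_vector_field[OF N(1)] structure_closed X Y Z
  have "X p (ap2 g (ap1 \<phi> Y) Z) = - X p (ap2 g Y (ap1 \<phi> Z))"
    by (simp add: phi_skew_fields Y Z tangent_map_uminus[OF vector_field_tangent[OF X]]
        smooth_metric vector_field_phi)
  then show ?thesis
    by (simp add: metric_deriv[OF N(2)] cov_endo_apply apply_simps closed g_simps phi_skew
        phi_skew_right[of "Y p"] g_sym[of _ p "Y p"])
qed

lemma xi_derivative:
  assumes N: "levi_civita A g N"
    and nearly: "\<And>X Y. V X \<Longrightarrow> V Y \<Longrightarrow> cov_endo N \<phi> X Y + cov_endo N \<phi> Y X =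
            fscale (\<lambda>p. 2 * ap2 g X Y p) \<xi> - fscale (ap1 \<eta> X) Y - fscale (ap1 \<eta> Y) X"
    and D: "linear_connection A D" "parallel_metric A D g" "skew_torsion A g D"
      "parallel_endo A D \<phi>" "parallel_vector A D \<xi>"
    and X: "V X"
  shows "N X \<xi> = - ap1 \<phi> X"
proof -
  have N': "linear_connection A N"
    using N by (simp add: levi_civita_def)
  note closed = connection_vector_field[OF N'] connection_vector_field[OF D(1)] structure_closed
  \<comment> \<open>With D W \<xi> = 0, alternation of D - N at (W, \<xi>) trades the derivative of
    W along \<xi> for the derivative of \<xi> along W.\<close>
  have dxi: "N \<xi> W = D \<xi> W - N W \<xi>" if "V W" for W
    using contorsion_alternating[OF N D(1,2,3) that vector_field_xi] D(5) that
    by (simp add: parallel_vector_def algebra_simps)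
  \<comment> \<open>At W = \<xi> the identity \<open>dxi\<close> says that this field is its own
    negative.\<close>
  have zero: "N \<xi> \<xi> = 0"
  proof -
    have "N \<xi> \<xi> p f = 0" for p f
      using fun_cong[OF fun_cong[OF dxi[OF vector_field_xi]], of p f] D(5) vector_field_xi
      by (simp add: parallel_vector_def)
    then show ?thesis by (simp add: fun_eq_iff)
  qed
  \<comment> \<open>In the nearly Sasakian identity at (W, \<xi>) the first summand is - \<phi> (N W
    \<xi>). By \<open>dxi\<close> and D \<phi> = 0 the second is \<phi> (N W \<xi>) - N (\<phi> W)
    \<xi>, so only - N (\<phi> W) \<xi> survives.\<close>
  have phi_image: "N (ap1 \<phi> W) \<xi> = W - fscale (ap1 \<eta> W) \<xi>" if W: "V W" for W
  proof (intro ext)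
    fix p f
    have par: "D \<xi> (ap1 \<phi> W) p = \<phi> p (D \<xi> W p)"
      using D(4) vector_field_xi W by (auto simp: parallel_endo_def cov_endo_def ap1_def fun_eq_iff)
    have "(cov_endo N \<phi> W \<xi> + cov_endo N \<phi> \<xi> W) p f
        = (fscale (\<lambda>p. 2 * ap2 g W \<xi> p) \<xi> - fscale (ap1 \<eta> W) \<xi> - fscale (ap1 \<eta> \<xi>) W) p f"
      by (simp only: nearly[OF W vector_field_xi])
    then have "- N (ap1 \<phi> W) \<xi> p f = \<xi> p f * \<eta> p (W p) - W p f"
      by (simp add: cov_endo_apply phi_xi_field connection_zero_right[OF N'] W dxi par closed
          structure_simps apply_simps)
    moreover have "(W - fscale (ap1 \<eta> W) \<xi>) p f = W p f - \<xi> p f * \<eta> p (W p)"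
      by (simp add: apply_simps)
    ultimately show "N (ap1 \<phi> W) \<xi> p f = (W - fscale (ap1 \<eta> W) \<xi>) p f"
      by linarith
  qed
  \<comment> \<open>Applying \<open>phi_image\<close> to W = \<phi> X reaches every X: the square of
    \<phi> sends X to - X + \<eta>(X) \<xi>, and the \<xi> part drops out by
    \<open>zero\<close>.\<close>
  have "N (ap1 \<phi> (ap1 \<phi> X)) \<xi> = N (fscale (\<lambda>p. -1) X + fscale (ap1 \<eta> X) \<xi>) \<xi>"
    by (rule arg_cong[of _ _ "\<lambda>W. N W \<xi>"]) (intro ext, simp add: apply_simps phi_phi X closed)
  also have "\<dots> = - N X \<xi>"
    by (simp add: connection_add_left[OF N'] connection_fscale_left[OF N'] X closed smooth_eta
        smooth_fun_const zero) (simp add: fun_eq_iff apply_simps)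
  finally have "- N X \<xi> = ap1 \<phi> X"
    by (simp add: phi_image X closed) (simp add: fun_eq_iff apply_simps structure_simps X closed)
  then show ?thesis by (metis minus_minus)
qed

text \<open>By the formula for N \<xi>, d eta is twice the fundamental 2-form, which is therefore
  closed. In \<open>ext_deriv_closed\<close> the derivatives N P Q of the argument fields on the
  left match the bracket terms on the right, because N is torsion-free; only the derivatives of
  \<phi> remain.\<close>

lemma cov_endo_cyclic:
  assumes N: "levi_civita A g N" and xi: "\<And>X. V X \<Longrightarrow> N X \<xi> = - ap1 \<phi> X"
    and X: "V X" and Y: "V Y" and Z: "V Z"
  shows "g p (cov_endo N \<phi> X Z p) (Y p) + g p (cov_endo N \<phi> Y X p) (Z p)
    + g p (cov_endo N \<phi> Z Y p) (X p) = 0"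
proof -
  have N': "linear_connection A N" "parallel_metric A N g"
    using N by (simp_all add: levi_civita_def)
  note closed = connection_vector_field[OF N'(1)] structure_closed vector_field_lie_bracket
  \<comment> \<open>Since \<eta> = g(-, \<xi>), metricity and vanishing torsion reduce d eta (P, Q)
    to g(Q, N P \<xi>) - g(P, N Q \<xi>); skewness of N \<xi> = - \<phi> makes the two terms
    equal.\<close>
  have d_eta: "ext_deriv \<eta> P Q = (\<lambda>p. 2 * ap2 g P (ap1 \<phi> Q) p)" if "V P" "V Q" for P Q
    by (intro ext)
      (simp add: ext_deriv_def eta_eq_metric deriv_along_def that closed metric_deriv[OF N'(2)] xi
        lie_bracket_levi_civita[OF N] apply_simps g_simps phi_skew g_sym[of "Q _"])
  have left: "P p (ext_deriv \<eta> Q R) = 2 * (g p (N P Q p) (\<phi> p (R p)) + g p (cov_endo N \<phi> P R p) (Q p)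
      - g p (N P R p) (\<phi> p (Q p)))" if "V P" "V Q" "V R" for P Q R
  proof -
    have "P p (ext_deriv \<eta> Q R) = 2 * P p (ap2 g Q (ap1 \<phi> R))"
      by (simp add: d_eta that tangent_map_scale[OF vector_field_tangent] smooth_metric closed)
    then show ?thesis
      by (simp add: metric_deriv[OF N'(2)] that closed cov_endo_apply apply_simps g_simps
          phi_skew_right[of "N P R p"] g_sym[of _ p "Q p"])
  qed
  have right: "ext_deriv \<eta> (lie_bracket P Q) R p
      = 2 * (g p (N P Q p) (\<phi> p (R p)) - g p (N Q P p) (\<phi> p (R p)))" if "V P" "V Q" "V R" for P Q R
    by (simp add: d_eta that closed lie_bracket_levi_civita[OF N] apply_simps g_simps)
  show ?thesis
    using ext_deriv_closed[OF one_form_eta X Y Z, of p]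
    by (simp add: left right X Y Z)
qed

lemma nearly_sasakian_imp_sasakian:
  assumes N: "levi_civita A g N"
    and nearly: "\<And>X Y. V X \<Longrightarrow> V Y \<Longrightarrow> cov_endo N \<phi> X Y + cov_endo N \<phi> Y X =
            fscale (\<lambda>p. 2 * ap2 g X Y p) \<xi> - fscale (ap1 \<eta> X) Y - fscale (ap1 \<eta> Y) X"
    and xi: "\<And>X. V X \<Longrightarrow> N X \<xi> = - ap1 \<phi> X"
    and X: "V X" and Y: "V Y"
  shows "cov_endo N \<phi> X Y = fscale (ap2 g X Y) \<xi> - fscale (ap1 \<eta> Y) X"
proof (rule vector_field_eqI)
  have N': "linear_connection A N" "parallel_metric A N g"
    using N by (simp_all add: levi_civita_def)
  note closed = connection_vector_field[OF N'(1)] vector_field_cov_endo[OF N'(1)] structure_closed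
    smooth_metric smooth_eta
  show "V (cov_endo N \<phi> X Y)" "V (fscale (ap2 g X Y) \<xi> - fscale (ap1 \<eta> Y) X)"
    by (simp_all add: closed X Y)
  fix Z p assume Z: "V Z"
  \<comment> \<open>\<open>b\<close> is the defect of the Sasakian identity for (P, Q), paired with
    R.\<close>
  define b where "b P Q R = g p (cov_endo N \<phi> P Q p) (R p) - g p (P p) (Q p) * \<eta> p (R p)
      + \<eta> p (Q p) * g p (P p) (R p)" for P Q R
  have skew12: "b P Q R = - b Q P R" if "V P" "V Q" "V R" for P Q R
  proof -
    have "g p ((cov_endo N \<phi> P Q + cov_endo N \<phi> Q P) p) (R p)
      = g p ((fscale (\<lambda>p. 2 * ap2 g P Q p) \<xi> - fscale (ap1 \<eta> P) Q - fscale (ap1 \<eta> Q) P) p) (R p)"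
      by (simp only: nearly[OF that(1,2)])
    then have "g p (cov_endo N \<phi> P Q p) (R p) + g p (cov_endo N \<phi> Q P p) (R p)
      = 2 * (g p (P p) (Q p) * \<eta> p (R p)) - \<eta> p (P p) * g p (Q p) (R p) - \<eta> p (Q p) * g p (P p) (R p)"
      by (simp add: that closed g_simps apply_simps structure_simps)
    then show ?thesis
      unfolding b_def g_sym[OF vector_field_tangent[OF that(2)] vector_field_tangent[OF that(1)]]
      by linarith
  qed
  have skew23: "b P Q R = - b P R Q" if "V P" "V Q" "V R" for P Q R
    by (simp add: b_def cov_endo_skew[OF N' that])
  \<comment> \<open>The correction terms in \<open>b\<close> cancel in this cyclic sum, so it equals
    the one in \<open>cov_endo_cyclic\<close>.\<close>
  have "b X Z Y + b Y X Z + b Z Y X = 0"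
    using cov_endo_cyclic[OF N xi X Y Z, of p]
    by (simp add: b_def g_sym[of "Y p" p "X p"] g_sym[of "Z p" p "X p"] g_sym[of "Z p" p "Y p"]
        X Y Z closed algebra_simps)
  \<comment> \<open>All three terms are odd permutations of b X Y Z, so the sum is - 3 * b X Y
    Z.\<close>
  then have "b X Y Z = 0"
    using skew23[OF X Y Z] skew12[OF X Y Z] skew12[OF Z Y X] skew23[OF Y Z X] by linarith
  then show "g p (cov_endo N \<phi> X Y p) (Z p) = g p ((fscale (ap2 g X Y) \<xi> - fscale (ap1 \<eta> Y) X) p) (Z p)"
    by (simp add: b_def X Y Z closed g_simps apply_simps structure_simps)
qed

section \<open>The connection with skew torsion on a Sasakian manifold\<close>

text \<open>In the Sasakian case this is the characteristic connection of Friedrich and Ivanov, N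
  plus half the torsion form eta wedge d eta. Lowered with \<open>g\<close>, the correction to N is
  the cyclic sum of \<eta>(X) g(Y, \<phi> Z).\<close>

definition contact_connection :: "'m connection \<Rightarrow> 'm connection" where
  "contact_connection N X Y = N X Y + fscale (ap1 \<eta> Y) (ap1 \<phi> X) - fscale (ap1 \<eta> X) (ap1 \<phi> Y)
     + fscale (ap2 g X (ap1 \<phi> Y)) \<xi>"

lemma contact_connection_apply:
  "contact_connection N X Y p = N X Y p + tscale (\<eta> p (Y p)) (\<phi> p (X p))
     - tscale (\<eta> p (X p)) (\<phi> p (Y p)) + tscale (g p (X p) (\<phi> p (Y p))) (\<xi> p)"
  by (simp add: contact_connection_def apply_simps)

lemma linear_contact_connection:
  assumes N: "linear_connection A N"
  shows "linear_connection A (contact_connection N)"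
  unfolding linear_connection_def
proof (intro conjI allI impI)
  fix X Y assume [simp]: "V X" "V Y"
  show "V (contact_connection N X Y)"
    by (simp add: contact_connection_def structure_closed connection_vector_field[OF N]
        smooth_eta smooth_metric)
  fix Z assume [simp]: "V Z"
  show "contact_connection N (X + Y) Z = contact_connection N X Z + contact_connection N Y Z"
    by (intro ext) (simp add: contact_connection_apply connection_add_left[OF N] structure_simps
        g_simps apply_simps structure_closed algebra_simps)
  show "contact_connection N X (Y + Z) = contact_connection N X Y + contact_connection N X Z"
    by (intro ext) (simp add: contact_connection_apply connection_add_right[OF N] structure_simps
        g_simps apply_simps structure_closed algebra_simps)
next
  fix f X Y assume [simp]: "smooth_fun A f" "V X" "V Y"
  show "contact_connection N (fscale f X) Y = fscale f (contact_connection N X Y)"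
    by (intro ext) (simp add: contact_connection_apply connection_fscale_left[OF N] structure_simps
        g_simps apply_simps structure_closed algebra_simps)
  show "contact_connection N X (fscale f Y)
      = fscale (deriv_along X f) Y + fscale f (contact_connection N X Y)"
    by (intro ext) (simp add: contact_connection_apply connection_fscale_right[OF N] structure_simps
        g_simps apply_simps structure_closed algebra_simps)
qed

text \<open>The lowered correction is skew in Y and Z, so it contributes nothing to the derivative
  of \<open>g\<close>.\<close>

lemma contact_connection_parallel_metric:
  assumes N: "linear_connection A N" "parallel_metric A N g"
  shows "parallel_metric A (contact_connection N) g"
  unfolding parallel_metric_def
proof (intro allI impI ext)
  fix X Y Z p assume [simp]: "V X" "V Y" "V Z"
  show "cov_metric (contact_connection N) g X Y Z p = 0 p"
    by (simp add: cov_metric_def deriv_along_def metric_deriv[OF N(2)] apply_simps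
        contact_connection_apply g_simps structure_simps structure_closed
        connection_vector_field[OF N(1)] phi_skew g_sym[of "Y p" p "\<phi> p (X p)"])
qed

text \<open>As N is torsion-free and the lowered correction is alternating, the torsion is twice
  that correction; this is the explicit cyclic sum in \<open>t\<close>.\<close>

lemma contact_connection_skew_torsion:
  assumes N: "levi_civita A g N"
  shows "skew_torsion A g (contact_connection N)"
proof -
  have N': "linear_connection A N" using N by (simp add: levi_civita_def)
  have t: "ap2 g (torsion (contact_connection N) X Y) Z p
    = 2 * (\<eta> p (X p) * g p (Y p) (\<phi> p (Z p)) + \<eta> p (Y p) * g p (Z p) (\<phi> p (X p))
        + \<eta> p (Z p) * g p (X p) (\<phi> p (Y p)))"
    and s: "g p (X p) (\<phi> p (Y p)) = - g p (Y p) (\<phi> p (X p))"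
    if [simp]: "V X" "V Y" "V Z" for X Y Z p
  proof -
    show "g p (X p) (\<phi> p (Y p)) = - g p (Y p) (\<phi> p (X p))"
      by (simp add: phi_skew_right[of "X p"] structure_closed)
    show "ap2 g (torsion (contact_connection N) X Y) Z p
      = 2 * (\<eta> p (X p) * g p (Y p) (\<phi> p (Z p)) + \<eta> p (Y p) * g p (Z p) (\<phi> p (X p))
        + \<eta> p (Z p) * g p (X p) (\<phi> p (Y p)))"
    proof -
      have "ap2 g (torsion (contact_connection N) X Y) Z p
        = g p (contact_connection N X Y p) (Z p) - g p (contact_connection N Y X p) (Z p)
          - (g p (N X Y p) (Z p) - g p (N Y X p) (Z p))"
        by (simp add: torsion_def lie_bracket_levi_civita[OF N] apply_simps g_simps structure_closed
            connection_vector_field[OF N']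
            connection_vector_field[OF linear_contact_connection[OF N']])
      then show ?thesis
        by (simp add: contact_connection_apply g_simps structure_simps structure_closed
            connection_vector_field[OF N'] phi_skew phi_skew_right[of "Y p" p "X p"]
            phi_skew_right[of "Z p" p "X p"] phi_skew_right[of "Z p" p "Y p"] algebra_simps)
    qed
  qed
  show ?thesis
    unfolding skew_torsion_def
  proof (intro allI impI conjI ext)
    fix X Y Z p assume [simp]: "V X" "V Y" "V Z"
    note ss = s[of Y X Z p] s[of Z X Y p] s[of Z Y X p]
    show "ap2 g (torsion (contact_connection N) X Y) Z p = (- ap2 g (torsion (contact_connection N) Y X) Z) p"
      "ap2 g (torsion (contact_connection N) X Y) Z p = (- ap2 g (torsion (contact_connection N) X Z) Y) p"
      "ap2 g (torsion (contact_connection N) X Y) Z p = (- ap2 g (torsion (contact_connection N) Z Y) X) p"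
      by (simp_all add: t ss)
  qed
qed

lemma sasakian_xi_derivative:
  assumes N: "linear_connection A N" "parallel_metric A N g"
    and sas: "\<And>X Y. V X \<Longrightarrow> V Y \<Longrightarrow> cov_endo N \<phi> X Y = fscale (ap2 g X Y) \<xi> - fscale (ap1 \<eta> Y) X"
    and X: "V X"
  shows "N X \<xi> = - ap1 \<phi> X"
proof
  fix p
  note closed = connection_vector_field[OF N(1)] structure_closed X
  \<comment> \<open>\<xi> has constant length, so N X \<xi> is orthogonal to \<xi>; on such vectors
    the square of \<phi> is - I.\<close>
  have "ap2 g \<xi> \<xi> = (\<lambda>p. 1)"
    by (intro ext) (simp add: apply_simps structure_simps structure_closed)
  then have "g p (N X \<xi> p) (\<xi> p) + g p (\<xi> p) (N X \<xi> p) = 0"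
    using metric_deriv[OF N(2) X vector_field_xi vector_field_xi, of p]
    by (simp add: tangent_map_const[OF vector_field_tangent[OF X]])
  then have eta: "\<eta> p (N X \<xi> p) = 0"
    by (simp add: structure_simps closed)
  have "cov_endo N \<phi> X \<xi> p = tscale (\<eta> p (X p)) (\<xi> p) - X p"
    by (simp add: sas vector_field_xi X fun_eq_iff apply_simps structure_simps closed)
  then have "- \<phi> p (N X \<xi> p) = tscale (\<eta> p (X p)) (\<xi> p) - X p"
    by (simp add: cov_endo_apply phi_xi_field connection_zero_right[OF N(1)] X)
  \<comment> \<open>The Sasakian identity at (X, \<xi>) gives only \<phi> (N X \<xi>); a second
    application of \<phi> recovers N X \<xi> itself.\<close>
  then have "\<phi> p (- \<phi> p (N X \<xi> p)) = \<phi> p (tscale (\<eta> p (X p)) (\<xi> p) - X p)"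
    by simp
  then show "N X \<xi> p = (- ap1 \<phi> X) p"
    by (simp add: structure_simps closed eta apply_simps fun_eq_iff)
qed

lemma contact_connection_parallel:
  assumes N: "linear_connection A N" "parallel_metric A N g"
    and sas: "\<And>X Y. V X \<Longrightarrow> V Y \<Longrightarrow> cov_endo N \<phi> X Y = fscale (ap2 g X Y) \<xi> - fscale (ap1 \<eta> Y) X"
  shows "parallel_endo A (contact_connection N) \<phi>"
    and "parallel_vector A (contact_connection N) \<xi>"
    and "parallel_form A (contact_connection N) \<eta>"
proof -
  note closed = connection_vector_field[OF N(1)] structure_closed
  show "parallel_endo A (contact_connection N) \<phi>"
    unfolding parallel_endo_def
  proof (intro allI impI ext)
    fix X Y p f assume [simp]: "V X" "V Y"
    \<comment> \<open>The correction changes the derivative of \<phi> by \<eta>(Y) X - g(X, Y)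
      \<xi>, which is minus the right side of the Sasakian identity.\<close>
    have "cov_endo N \<phi> X Y p f = (fscale (ap2 g X Y) \<xi> - fscale (ap1 \<eta> Y) X) p f"
      by (simp add: sas)
    then show "cov_endo (contact_connection N) \<phi> X Y p f = 0 p f"
      by (simp add: cov_endo_apply contact_connection_apply apply_simps closed structure_simps g_simps
          algebra_simps)
  qed
  show xi: "parallel_vector A (contact_connection N) \<xi>"
    unfolding parallel_vector_def
    by (intro allI impI ext) (simp add: contact_connection_apply sasakian_xi_derivative[OF N sas]
        apply_simps closed structure_simps g_simps)
  \<comment> \<open>Since \<eta> = g(-, \<xi>), this follows from the parallelism of
    \<open>g\<close> and \<xi>.\<close>
  show "parallel_form A (contact_connection N) \<eta>"
    unfolding parallel_form_def
  proof (intro allI impI ext)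
    fix X Y p assume [simp]: "V X" "V Y"
    have "V (contact_connection N X Y)"
      using connection_vector_field[OF linear_contact_connection[OF N(1)]] by simp
    then show "cov_form (contact_connection N) \<eta> X Y p = 0 p"
      using xi metric_deriv[OF contact_connection_parallel_metric[OF N], of X Y \<xi> p]
      by (simp add: cov_form_def deriv_along_def eta_eq_metric vector_field_xi ap2_apply
          parallel_vector_def g_zero_right vector_field_tangent)
  qed
qed

end

theorem proposition7p1:
  fixes A :: "('m::{t2_space,second_countable_topology}, 'e::euclidean_space) atlas"
    and n :: nat
    and \<phi> :: "'m \<Rightarrow> 'm tvec \<Rightarrow> 'm tvec"
    and \<xi> :: "'m vfield"
    and \<eta> :: "'m \<Rightarrow> 'm tvec \<Rightarrow> real"
    and g :: "'m \<Rightarrow> 'm tvec \<Rightarrow> 'm tvec \<Rightarrow> real"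
  assumes "nearly_sasakian A n \<phi> \<xi> \<eta> g"
  shows "(\<exists>D. linear_connection A D \<and> skew_torsion A g D \<and>
            parallel_endo A D \<phi> \<and> parallel_vector A D \<xi> \<and>
            parallel_form A D \<eta> \<and> parallel_metric A D g)
         \<longleftrightarrow> sasakian A n \<phi> \<xi> \<eta> g"
proof -
  interpret almost_contact A n \<phi> \<xi> \<eta> g
    using assms by unfold_locales (simp add: nearly_sasakian_def)
  show ?thesis
  proof
    assume "\<exists>D. linear_connection A D \<and> skew_torsion A g D \<and> parallel_endo A D \<phi> \<and>
      parallel_vector A D \<xi> \<and> parallel_form A D \<eta> \<and> parallel_metric A D g"
    then obtain D where D: "linear_connection A D" "parallel_metric A D g" "skew_torsion A g D"
      "parallel_endo A D \<phi>" "parallel_vector A D \<xi>"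
      by blast
    obtain N where N: "levi_civita A g N"
      and nearly: "\<And>X Y. V X \<Longrightarrow> V Y \<Longrightarrow> cov_endo N \<phi> X Y + cov_endo N \<phi> Y X =
            fscale (\<lambda>p. 2 * ap2 g X Y p) \<xi> - fscale (ap1 \<eta> X) Y - fscale (ap1 \<eta> Y) X"
      using assms unfolding nearly_sasakian_def by blast
    have xi: "N X \<xi> = - ap1 \<phi> X" if "V X" for X
      by (rule xi_derivative[OF N nearly D that])
    show "sasakian A n \<phi> \<xi> \<eta> g"
      unfolding sasakian_def
      using acm N nearly_sasakian_imp_sasakian[OF N nearly xi] by blast
  next
    assume "sasakian A n \<phi> \<xi> \<eta> g"
    then obtain N where N: "levi_civita A g N"
      and sas: "\<And>X Y. V X \<Longrightarrow> V Y \<Longrightarrow> cov_endo N \<phi> X Y = fscale (ap2 g X Y) \<xi> - fscale (ap1 \<eta> Y) X"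
      unfolding sasakian_def by blast
    have N': "linear_connection A N" "parallel_metric A N g"
      using N by (simp_all add: levi_civita_def)
    \<comment> \<open>The witness is \<open>contact_connection N\<close>, with N the Levi-Civita
      connection given by the Sasakian condition.\<close>
    show "\<exists>D. linear_connection A D \<and> skew_torsion A g D \<and> parallel_endo A D \<phi> \<and>
      parallel_vector A D \<xi> \<and> parallel_form A D \<eta> \<and> parallel_metric A D g"
      using linear_contact_connection[OF N'(1)] contact_connection_skew_torsion[OF N]
        contact_connection_parallel[OF N' sas] contact_connection_parallel_metric[OF N']
      by blast
  qed
qed

end
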